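(* Let $g$ be a log-concave probability mass function on $\mathbf{Z}_+$. Then $g$ is the unique maximizer of the entropy $H$ in the set $$F=\{f : f \text{ is a probability mass function on } \mathbf{Z}_+,\ f\leq_{\mathrm{lc}} g,\ E(f)=E(g)\}.$$
   Context: $\mathbf{Z}_+=\{0,1,2,\ldots\}$. A probability mass function (pmf) on $\mathbf{Z}_+$ is a sequence $f=\{f_i, i\ge 0\}$ of non-negative reals with $\sum_i f_i=1$; $\mathrm{supp}(f)=\{i: f_i>0\}$, and $E(f)=\sum_i i f_i$ is its mean. A non-negative sequence $u=\{u_i,i\ge0\}$ is log-concave if its support is an interval in $\mathbf{Z}_+$ (a set of consecutive integers, possibly infinite) and $u_i^2\ge u_{i+1}u_{i-1}$ for all $i\geq 1$. For two pmf's $f,g$ on $\mathbf{Z}_+$, write $f\leq_{\mathrm{lc}} g$ if: (1) each of $f$ and $g$ is supported on an interval in $\mathbf{Z}_+$; (2) $\mathrm{supp}(f)\subset\mathrm{supp}(g)$; (3) $\log(f_i/g_i)$ is concave in $i\in\mathrm{supp}(f)$. The Shannon entropy is $H(f)=-\sum_{i=0}^\infty f_i\log(f_i)$, with $0\log 0=0$. *)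

theory Defs
  imports "HOL-Probability.Probability"
begin

definition nat_interval :: "nat set \<Rightarrow> bool" where
  "nat_interval S \<longleftrightarrow> (\<forall>i\<in>S. \<forall>k\<in>S. {i..k} \<subseteq> S)"

definition log_concave :: "(nat \<Rightarrow> real) \<Rightarrow> bool" where
  "log_concave u \<longleftrightarrow>
     (\<forall>i. u i \<ge> 0) \<and> nat_interval {i. u i > 0} \<and>
     (\<forall>i\<ge>1. (u i)\<^sup>2 \<ge> u (i + 1) * u (i - 1))"

text \<open>Concavity of the restriction of \<open>h\<close> to a set of integers, with the interpolation
  inequality for \<open>i < j < k\<close> multiplied by \<open>k - i\<close>.\<close>

definition concave_nat_on :: "nat set \<Rightarrow> (nat \<Rightarrow> real) \<Rightarrow> bool" where
  "concave_nat_on S h \<longleftrightarrow>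
     (\<forall>i\<in>S. \<forall>j\<in>S. \<forall>k\<in>S. i < j \<longrightarrow> j < k \<longrightarrow>
        (real k - real i) * h j \<ge> (real k - real j) * h i + (real j - real i) * h k)"

definition lc_le :: "nat pmf \<Rightarrow> nat pmf \<Rightarrow> bool" (infix "\<le>lc" 50) where
  "f \<le>lc g \<longleftrightarrow>
     nat_interval (set_pmf f) \<and> nat_interval (set_pmf g) \<and>
     set_pmf f \<subseteq> set_pmf g \<and>
     concave_nat_on (set_pmf f) (\<lambda>i. ln (pmf f i / pmf g i))"

text \<open>Mean and entropy are sums of non-negative terms. They are taken in \<open>[0, \<infinity>]\<close>, so that a
  divergent sum has the value \<open>\<infinity>\<close>. Since \<open>ln 0 = 0\<close>, the convention \<open>0 log 0 = 0\<close> is built in.\<close>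

definition pmf_mean :: "nat pmf \<Rightarrow> ennreal" where
  "pmf_mean f = (\<Sum>i. ennreal (real i * pmf f i))"

definition shannon_entropy :: "nat pmf \<Rightarrow> ennreal" where
  "shannon_entropy f = (\<Sum>i. ennreal (- (pmf f i * ln (pmf f i))))"

definition lc_class :: "nat pmf \<Rightarrow> nat pmf set" where
  "lc_class g = {f. f \<le>lc g \<and> pmf_mean f = pmf_mean g}"

end

theory Submission imports Defs begin

text \<open>
  Let \<open>S = {i. f i > g i}\<close>. Concavity of \<open>ln (f / g)\<close> makes \<open>S\<close> a set of consecutive integers,
  and \<open>S\<close> is bounded, since otherwise \<open>f\<close> would exceed \<open>g\<close> exactly on a tail and would have the
  larger mean. As \<open>ln g\<close> is concave as well, there is an affine function \<open>l\<close> with \<open>ln g \<ge> l\<close>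
  on \<open>S\<close> and \<open>ln g \<le> l\<close> on the rest of the support of \<open>g\<close>: the chord of \<open>ln g\<close> over the end
  points of \<open>S\<close>, or a supporting line if \<open>S\<close> is a single point. So
  \<open>(f i - g i) * (ln (g i) - l i) \<ge> 0\<close> for every \<open>i\<close> in that support. Together with the Gibbs
  inequality in its pointwise form this gives
  \<open>- f ln f \<le> - f ln g + (g - f) \<le> - g ln g + (g - f) l + (g - f)\<close>,
  where the first inequality is strict wherever \<open>f\<close> and \<open>g\<close> differ. Summing over all \<open>i\<close>, the
  last two terms on the right contribute nothing, because \<open>l\<close> is affine and \<open>f\<close> and \<open>g\<close> have
  the same mass and the same mean.

  The comparison is made term by term, so that the convergence of the series for \<open>H(f)\<close> follows
  from that of the series for the mean and the entropy of \<open>g\<close>. These two converge because a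
  summable log-concave sequence decays geometrically.
\<close>

section \<open>Log-concave sequences\<close>

lemma nat_intervalD:
  "nat_interval S \<Longrightarrow> i \<in> S \<Longrightarrow> k \<in> S \<Longrightarrow> i \<le> j \<Longrightarrow> j \<le> k \<Longrightarrow> j \<in> S"
  unfolding nat_interval_def by (meson atLeastAtMost_iff subsetD)

lemma log_concave_nonneg: "log_concave u \<Longrightarrow> 0 \<le> u i"
  by (simp add: log_concave_def)

lemma log_concave_pos_between:
  assumes "log_concave u" "0 < u i" "0 < u k" "i \<le> j" "j \<le> k"
  shows "0 < u j"
  using assms nat_intervalD[of "{i. 0 < u i}" i k j] by (simp add: log_concave_def)

text \<open>The ratios \<open>u (k + 1) / u k\<close> never increase with \<open>k\<close>. The cross-multiplied form remains meaningful
  where \<open>u\<close> vanishes, so that it also describes the tail beyond a finite support.\<close>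

lemma log_concave_ratio_antimono:
  assumes u: "log_concave u" and pos: "0 < u i" and le: "i \<le> k"
  shows "u (Suc k) * u i \<le> u (Suc i) * u k"
  using le
proof (induction k rule: dec_induct)
  case base
  then show ?case by simp
next
  case (step k)
  show ?case
  proof (cases "u (Suc (Suc k)) = 0")
    case True
    then show ?thesis by (simp add: log_concave_nonneg[OF u])
  next
    case False
    then have "0 < u (Suc (Suc k))"
      using log_concave_nonneg[OF u, of "Suc (Suc k)"] by linarith
    then have pk: "0 < u k" and pk1: "0 < u (Suc k)"
      using log_concave_pos_between[OF u pos] step.hyps by force+
    have "u (Suc (Suc k)) * u k \<le> (u (Suc k))\<^sup>2"
      using u unfolding log_concave_def by (metis Suc_eq_plus1 diff_Suc_1 le_add2)
    then have "u (Suc (Suc k)) * u k * u i \<le> (u (Suc k))\<^sup>2 * u i"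
      using pos by (intro mult_right_mono) auto
    also have "\<dots> = u (Suc k) * (u (Suc k) * u i)"
      by (simp add: power2_eq_square)
    also have "\<dots> \<le> u (Suc k) * (u (Suc i) * u k)"
      using step.IH pk1 by (intro mult_left_mono) auto
    finally have "(u (Suc (Suc k)) * u i) * u k \<le> (u (Suc i) * u (Suc k)) * u k"
      by (simp add: mult_ac)
    then show ?thesis using pk by simp
  qed
qed

lemma log_concave_ln_diff_antimono:
  assumes u: "log_concave u" and "0 < u i" "0 < u (Suc k)" "i \<le> k"
  shows "ln (u (Suc k)) - ln (u k) \<le> ln (u (Suc i)) - ln (u i)"
proof -
  have pk: "0 < u k" and pi: "0 < u (Suc i)"
    using assms by (auto intro: log_concave_pos_between[of u i "Suc k"])
  have "ln (u (Suc k) * u i) \<le> ln (u (Suc i) * u k)"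
    using log_concave_ratio_antimono[OF u] assms pk pi by simp
  then show ?thesis using assms pk pi by (simp add: ln_mult)
qed

text \<open>The line through two consecutive points of the graph of \<open>ln u\<close> is nowhere below the graph,
  because the increments of \<open>ln u\<close> are at most its slope to the right and at least its slope to
  the left.\<close>

lemma log_concave_below_step_line:
  assumes u: "log_concave u" and pi: "0 < u i" "0 < u (Suc i)" and pm: "0 < u m"
  shows "ln (u m) \<le> ln (u i) + (ln (u (Suc i)) - ln (u i)) * (real m - real i)"
proof (cases "i \<le> m")
  case True
  then show ?thesis using pm
  proof (induction m rule: dec_induct)
    case base
    then show ?case by simp
  next
    case (step m)
    have "0 < u m"
      using log_concave_pos_between[OF u pi(1) step.prems] step.hyps by simp
    then show ?case
      using step.IH log_concave_ln_diff_antimono[OF u pi(1) step.prems step.hyps(1)]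
      by (simp add: algebra_simps)
  qed
next
  case False
  then have "m \<le> i" by simp
  then show ?thesis using pm
  proof (induction m rule: inc_induct)
    case base
    then show ?case by simp
  next
    case (step m)
    have "0 < u (Suc m)"
      using log_concave_pos_between[OF u step.prems pi(1), of "Suc m"] step.hyps by simp
    then show ?case
      using step.IH log_concave_ln_diff_antimono[OF u step.prems pi(2)] step.hyps
      by (simp add: algebra_simps)
  qed
qed

lemma log_concave_supporting_line:
  assumes u: "log_concave u" and pj: "0 < u j"
  shows "\<exists>c. \<forall>m. 0 < u m \<longrightarrow> ln (u m) \<le> ln (u j) + c * (real m - real j)"
proof -
  consider (right) "0 < u (Suc j)" | (left) i where "j = Suc i" "0 < u i"
    | (point) "\<forall>m. 0 < u m \<longrightarrow> m = j"
  proof (cases "\<exists>m. 0 < u m \<and> m \<noteq> j")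
    case True
    then obtain m where m: "0 < u m" "m \<noteq> j" by blast
    show ?thesis
    proof (cases "j < m")
      case True
      then show ?thesis using log_concave_pos_between[OF u pj m(1), of "Suc j"] right by simp
    next
      case False
      then have "j = Suc (j - 1)" "m \<le> j - 1" using m by auto
      then show ?thesis
        using log_concave_pos_between[OF u m(1) pj, of "j - 1"] left[of "j - 1"] by simp
    qed
  next
    case False
    then show ?thesis using point by blast
  qed
  then show ?thesis
  proof cases
    case right
    then show ?thesis using log_concave_below_step_line[OF u pj right] by blast
  next
    case (left i)
    have "ln (u m) \<le> ln (u j) + (ln (u j) - ln (u i)) * (real m - real j)" if "0 < u m" for m
      using log_concave_below_step_line[OF u left(2) _ that] pj left(1)
      by (simp add: algebra_simps)
    then show ?thesis by blast
  next
    case point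
    then show ?thesis by auto
  qed
qed

text \<open>Averaging the supporting line at \<open>j\<close> over \<open>i\<close> and \<open>k\<close> turns the local condition of
  log-concavity into the interpolation inequality.\<close>

lemma log_concave_imp_concave_ln:
  assumes u: "log_concave u"
  shows "concave_nat_on {i. 0 < u i} (\<lambda>i. ln (u i))"
  unfolding concave_nat_on_def
proof (intro ballI impI)
  fix i j k assume ijk: "i \<in> {i. 0 < u i}" "j \<in> {i. 0 < u i}" "k \<in> {i. 0 < u i}"
    and "i < j" "j < k"
  obtain c where c: "\<And>m. 0 < u m \<Longrightarrow> ln (u m) \<le> ln (u j) + c * (real m - real j)"
    using log_concave_supporting_line[OF u, of j] ijk by auto
  have "(real k - real j) * ln (u i) + (real j - real i) * ln (u k)
      \<le> (real k - real j) * (ln (u j) + c * (real i - real j))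
        + (real j - real i) * (ln (u j) + c * (real k - real j))"
    using c ijk \<open>i < j\<close> \<open>j < k\<close> by (intro add_mono mult_left_mono) auto
  also have "\<dots> = (real k - real i) * ln (u j)"
    by (simp add: algebra_simps)
  finally show "(real k - real j) * ln (u i) + (real j - real i) * ln (u k)
      \<le> (real k - real i) * ln (u j)" .
qed

text \<open>For \<open>a < b\<close> the line is the chord over the two end points, and for \<open>a = b\<close> a supporting
  line.\<close>

lemma log_concave_separating_line:
  assumes u: "log_concave u" and pa: "0 < u a" and pb: "0 < u b" and "a \<le> b"
  shows "\<exists>s t. (\<forall>m\<in>{a..b}. s + t * real m \<le> ln (u m)) \<and>
               (\<forall>m. 0 < u m \<longrightarrow> m \<notin> {a..b} \<longrightarrow> ln (u m) \<le> s + t * real m)"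
proof (cases "a = b")
  case True
  obtain c where c: "\<And>m. 0 < u m \<Longrightarrow> ln (u m) \<le> ln (u a) + c * (real m - real a)"
    using log_concave_supporting_line[OF u pa] by auto
  show ?thesis
    using c True
    by (intro exI[of _ "ln (u a) - c * real a"] exI[of _ c]) (auto simp: algebra_simps)
next
  case False
  then have ab: "a < b" using \<open>a \<le> b\<close> by simp
  define t where "t = (ln (u b) - ln (u a)) / (real b - real a)"
  define s where "s = ln (u a) - t * real a"
  have ea: "ln (u a) = s + t * real a" by (simp add: s_def)
  have "t * (real b - real a) = ln (u b) - ln (u a)"
    using ab by (simp add: t_def)
  then have eb: "ln (u b) = s + t * real b"
    by (simp add: s_def algebra_simps)
  have conc: "(real k - real j) * ln (u i) + (real j - real i) * ln (u k)
      \<le> (real k - real i) * ln (u j)"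
    if "0 < u i" "0 < u j" "0 < u k" "i < j" "j < k" for i j k
    using log_concave_imp_concave_ln[OF u] that unfolding concave_nat_on_def by auto
  have "s + t * real m \<le> ln (u m)" if m: "m \<in> {a..b}" for m
  proof (cases "m = a \<or> m = b")
    case True
    then show ?thesis using ea eb by auto
  next
    case False
    then have "a < m" "m < b" using m by auto
    moreover have "0 < u m" using log_concave_pos_between[OF u pa pb] m by auto
    ultimately have "(real b - real a) * (s + t * real m) \<le> (real b - real a) * ln (u m)"
      using conc[of a m b] pa pb unfolding ea eb by (simp add: algebra_simps)
    then show ?thesis using ab by simp
  qed
  moreover have "ln (u m) \<le> s + t * real m" if pm: "0 < u m" and m: "m \<notin> {a..b}" for m
  proof (cases "m < a")
    case True
    then have "(real b - real a) * ln (u m) \<le> (real b - real a) * (s + t * real m)"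
      using conc[of m a b] pa pb pm ab unfolding ea eb by (simp add: algebra_simps)
    then show ?thesis using ab by simp
  next
    case False
    then have "b < m" using m by auto
    then have "(real b - real a) * ln (u m) \<le> (real b - real a) * (s + t * real m)"
      using conc[of a b m] pa pb pm ab unfolding ea eb by (simp add: algebra_simps)
    then show ?thesis using ab by simp
  qed
  ultimately show ?thesis by blast
qed

section \<open>Finiteness of mean and entropy\<close>

text \<open>A null sequence that is positive somewhere decreases somewhere after that point; from
  then on no ratio exceeds the one at the decrease.\<close>

lemma log_concave_geometric_tail:
  assumes u: "log_concave u" and lim: "u \<longlonglongrightarrow> 0" and pos: "0 < u j"
  shows "\<exists>C r N. 0 \<le> C \<and> 0 < r \<and> r < 1 \<and> (\<forall>n\<ge>N. u n \<le> C * r ^ n)"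
proof -
  have "\<exists>N\<ge>j. 0 < u N \<and> u (Suc N) < u N"
  proof (rule ccontr)
    assume no: "\<not> ?thesis"
    have "u j \<le> u n" if "j \<le> n" for n
      using that
    proof (induction n rule: dec_induct)
      case (step n)
      then have "0 < u n" using pos by linarith
      then show ?case using no step by (meson not_le order_trans)
    qed simp
    then have "u j \<le> 0" using LIMSEQ_le_const[OF lim] by blast
    then show False using pos by simp
  qed
  then obtain N where N: "0 < u N" "u (Suc N) < u N" by blast
  \<comment> \<open>The ratio at \<open>N\<close> can be \<open>0\<close>; the lower bound \<open>1 / 2\<close> makes \<open>r\<close> positive.\<close>
  define r where "r = max (1 / 2) (u (Suc N) / u N)"
  have r: "0 < r" "r < 1" using N by (auto simp: r_def)
  have ratio: "u (Suc n) \<le> r * u n" if "N \<le> n" for n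
  proof -
    have "u (Suc n) \<le> u (Suc N) / u N * u n"
      using log_concave_ratio_antimono[OF u N(1) that] N(1) by (simp add: field_simps)
    also have "\<dots> \<le> r * u n"
      by (intro mult_right_mono) (auto simp: r_def log_concave_nonneg[OF u])
    finally show ?thesis .
  qed
  have "u n \<le> u N / r ^ N * r ^ n" if "N \<le> n" for n
    using that
  proof (induction n rule: dec_induct)
    case base
    then show ?case using r by simp
  next
    case (step n)
    have "u (Suc n) \<le> r * u n" by (rule ratio[OF step.hyps(1)])
    also have "\<dots> \<le> r * (u N / r ^ N * r ^ n)"
      using step.IH r by (intro mult_left_mono) auto
    finally show ?case by (simp add: mult_ac)
  qed
  moreover have "0 \<le> u N / r ^ N" using N r by simp
  ultimately show ?thesis using r by blast
qed

lemma summable_mean_of_geometric_tail: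
  fixes u :: "nat \<Rightarrow> real"
  assumes "\<And>n. 0 \<le> u n" "0 \<le> C" "0 < r" "r < 1" and tail: "\<And>n. N \<le> n \<Longrightarrow> u n \<le> C * r ^ n"
  shows "summable (\<lambda>n. real n * u n)"
proof (rule summable_comparison_test')
  have "summable (\<lambda>n. real (Suc n) * r ^ n)"
    using geometric_deriv_sums[of r] assms by (auto simp: sums_iff)
  then show "summable (\<lambda>n. C * (real (Suc n) * r ^ n))" by (rule summable_mult)
  fix n assume "N \<le> n"
  then have "real n * u n \<le> real (Suc n) * (C * r ^ n)"
    using tail[of n] assms by (intro mult_mono) auto
  then show "norm (real n * u n) \<le> C * (real (Suc n) * r ^ n)"
    using assms by (simp add: mult_ac)
qed

lemma neg_mult_ln_le_sqrt:
  fixes x :: real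
  assumes "0 \<le> x"
  shows "- (x * ln x) \<le> 2 * sqrt x"
proof (cases "x = 0")
  case False
  then have x: "0 < x" using assms by simp
  have "ln (1 / sqrt x) \<le> 1 / sqrt x - 1"
    using x by (intro ln_le_minus_one) simp
  then have "- ln x \<le> 2 / sqrt x"
    using x by (simp add: ln_div ln_sqrt)
  then have "x * - ln x \<le> x * (2 / sqrt x)"
    using x by (intro mult_left_mono) auto
  also have "\<dots> = 2 * sqrt x"
    using x by (simp add: field_simps)
  finally show ?thesis by simp
qed simp

lemma neg_mult_ln_nonneg:
  fixes x :: real
  assumes "0 \<le> x" "x \<le> 1"
  shows "0 \<le> - (x * ln x)"
proof (cases "x = 0")
  case False
  then have "ln x \<le> 0" using assms by simp
  then show ?thesis using assms by (simp add: mult_nonneg_nonpos)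
qed simp

text \<open>The bound \<open>- x ln x \<le> 2 * sqrt x\<close> preserves geometric decay, with ratio \<open>sqrt r\<close>.\<close>

lemma summable_entropy_of_geometric_tail:
  fixes u :: "nat \<Rightarrow> real"
  assumes u: "\<And>n. 0 \<le> u n" "\<And>n. u n \<le> 1" and r: "0 \<le> C" "0 < r" "r < 1"
    and tail: "\<And>n. N \<le> n \<Longrightarrow> u n \<le> C * r ^ n"
  shows "summable (\<lambda>n. - (u n * ln (u n)))"
proof (rule summable_comparison_test')
  have "sqrt r < 1" using r by simp
  then have "summable (\<lambda>n. sqrt r ^ n)" using r by (intro summable_geometric) simp
  then show "summable (\<lambda>n. 2 * sqrt C * sqrt r ^ n)" by (rule summable_mult)
  fix n assume "N \<le> n"
  then have "sqrt (u n) \<le> sqrt (C * r ^ n)" using tail by simp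
  also have "\<dots> = sqrt C * sqrt r ^ n" by (simp add: real_sqrt_mult real_sqrt_power)
  finally have "- (u n * ln (u n)) \<le> 2 * sqrt C * sqrt r ^ n"
    using neg_mult_ln_le_sqrt[OF u(1), of n] by linarith
  then show "norm (- (u n * ln (u n))) \<le> 2 * sqrt C * sqrt r ^ n"
    using neg_mult_ln_nonneg[OF u, of n] by (simp only: real_norm_def abs_of_nonneg)
qed

section \<open>Probability mass functions on the natural numbers\<close>

lemma pmf_sums_one: "pmf (f :: nat pmf) sums 1"
proof -
  have "(\<Sum>i. ennreal (pmf f i)) = (\<integral>\<^sup>+ i. ennreal (pmf f i) \<partial>count_space UNIV)"
    by (rule nn_integral_count_space_nat[symmetric])
  also have "\<dots> = emeasure (measure_pmf f) UNIV"
    by (rule nn_integral_pmf)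
  also have "\<dots> = 1"
    using measure_pmf.emeasure_space_1[of f] by (simp only: space_measure_pmf)
  finally have eq: "(\<Sum>i. ennreal (pmf f i)) = ennreal 1" by (simp only: ennreal_1)
  have "(\<lambda>i. ennreal (pmf f i)) sums ennreal 1"
    using summable_sums[OF summableI, of "\<lambda>i. ennreal (pmf f i)"] unfolding eq .
  then show ?thesis by (subst (asm) sums_ennreal) (rule pmf_nonneg zero_le_one)+
qed

lemma log_concave_pmf_finite_mean_entropy:
  fixes g :: "nat pmf"
  assumes g: "log_concave (pmf g)"
  shows "summable (\<lambda>i. real i * pmf g i)" "summable (\<lambda>i. - (pmf g i * ln (pmf g i)))"
proof -
  obtain j where "0 < pmf g j"
    using set_pmf_not_empty[of g] by (auto intro: pmf_positive)
  moreover have "pmf g \<longlonglongrightarrow> 0"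
    using pmf_sums_one[of g] by (intro summable_LIMSEQ_zero) (auto simp: sums_iff)
  ultimately obtain C r N where r: "0 \<le> C" "0 < r" "r < 1"
      and tail: "\<And>n. N \<le> n \<Longrightarrow> pmf g n \<le> C * r ^ n"
    using log_concave_geometric_tail[OF g] by blast
  show "summable (\<lambda>i. real i * pmf g i)"
    by (rule summable_mean_of_geometric_tail[OF pmf_nonneg r tail])
  show "summable (\<lambda>i. - (pmf g i * ln (pmf g i)))"
    by (rule summable_entropy_of_geometric_tail[OF pmf_nonneg pmf_le_1 r tail])
qed

lemma pmf_mean_eq_sums:
  assumes "summable (\<lambda>i. real i * pmf g i)" "pmf_mean f = pmf_mean g"
  shows "(\<lambda>i. real i * pmf f i) sums (\<Sum>i. real i * pmf g i)"
proof -
  have eq: "(\<Sum>i. ennreal (real i * pmf f i)) = ennreal (\<Sum>i. real i * pmf g i)"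
    using assms by (simp add: pmf_mean_def suminf_ennreal2)
  then have "summable (\<lambda>i. real i * pmf f i)"
    by (intro summable_suminf_not_top) auto
  then show ?thesis
    using eq assms by (simp add: suminf_ennreal2 sums_iff suminf_nonneg)
qed

lemma pmf_neq_imp_greater:
  fixes f g :: "nat pmf"
  assumes "f \<noteq> g"
  shows "\<exists>i. pmf g i < pmf f i"
proof (rule ccontr)
  assume no: "\<not> ?thesis"
  obtain i where "pmf f i \<noteq> pmf g i" using assms by (metis pmf_eqI)
  moreover have le: "pmf f n \<le> pmf g n" for n using no by (auto simp: not_less)
  ultimately have "pmf f i < pmf g i" by (simp add: order.strict_iff_order)
  then have "0 < (\<Sum>i. pmf g i - pmf f i)"
    using le sums_summable[OF pmf_sums_one]
    by (intro suminf_pos2[of _ i] summable_diff) auto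
  also have "\<dots> = 1 - 1"
    using sums_diff[OF pmf_sums_one[of g] pmf_sums_one[of f]] by (rule sums_unique[symmetric])
  finally show False by simp
qed

section \<open>The set where one mass function exceeds the other\<close>

lemma lc_le_greater_pos:
  assumes "f \<le>lc g" "pmf g i < pmf f i"
  shows "0 < pmf f i" "0 < pmf g i"
proof -
  show pos: "0 < pmf f i" using assms(2) pmf_nonneg[of g i] by linarith
  then have "i \<in> set_pmf f" by (simp add: set_pmf_iff)
  then have "i \<in> set_pmf g" using assms(1) unfolding lc_le_def by blast
  then show "0 < pmf g i" by (rule pmf_positive)
qed

text \<open>Inside the support of \<open>f\<close> the condition \<open>f i > g i\<close> reads \<open>ln (f i / g i) > 0\<close>, and the
  superlevel sets of a concave function are intervals.\<close>

lemma lc_le_greater_interval: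
  assumes fg: "f \<le>lc g"
  shows "nat_interval {i. pmf g i < pmf f i}"
  unfolding nat_interval_def
proof (intro ballI subsetI)
  let ?h = "\<lambda>i. ln (pmf f i / pmf g i)"
  fix i k j assume i: "i \<in> {i. pmf g i < pmf f i}" and k: "k \<in> {i. pmf g i < pmf f i}"
    and j: "j \<in> {i..k}"
  have supp: "m \<in> set_pmf f \<and> 0 < ?h m" if "m \<in> {i. pmf g i < pmf f i}" for m
    using that lc_le_greater_pos[OF fg, of m] by (simp add: set_pmf_iff)
  show "j \<in> {i. pmf g i < pmf f i}"
  proof (cases "j = i \<or> j = k")
    case False
    then have ij: "i < j" "j < k" using j by auto
    have jf: "j \<in> set_pmf f"
      using fg supp[OF i] supp[OF k] ij nat_intervalD[of "set_pmf f" i k j]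
      by (simp add: lc_le_def)
    have "(real k - real j) * ?h i + (real j - real i) * ?h k \<le> (real k - real i) * ?h j"
      using fg jf supp[OF i] supp[OF k] ij unfolding lc_le_def concave_nat_on_def by blast
    moreover have "0 < (real k - real j) * ?h i + (real j - real i) * ?h k"
      using supp[OF i] supp[OF k] ij by (intro add_pos_pos mult_pos_pos) auto
    ultimately have "0 < (real k - real i) * ?h j" by linarith
    then have h: "0 < ?h j" using ij by (simp add: zero_less_mult_iff)
    have "0 < pmf f j" "0 < pmf g j"
      using jf fg by (auto simp: lc_le_def intro: pmf_positive)
    then show ?thesis using h by simp
  qed (use i k in auto)
qed

text \<open>If \<open>f\<close> exceeded \<open>g\<close> exactly on \<open>{a..}\<close>, every term of \<open>\<Sum>i. (i - a) (f i - g i)\<close> would be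
  non-negative and some would be positive, whereas equal mass and equal mean make the sum \<open>0\<close>.\<close>

lemma lc_class_greater_bounded:
  assumes f: "f \<in> lc_class g" and mean: "summable (\<lambda>i. real i * pmf g i)"
  shows "finite {i. pmf g i < pmf f i}" (is "finite ?S")
proof (rule ccontr)
  assume inf: "infinite ?S"
  have int: "nat_interval ?S" using f lc_le_greater_interval by (simp add: lc_class_def)
  have "?S \<noteq> {}" using inf finite.emptyI by metis
  define a where "a = (LEAST i. i \<in> ?S)"
  have a: "a \<in> ?S" "\<And>i. i \<in> ?S \<Longrightarrow> a \<le> i"
    unfolding a_def using \<open>?S \<noteq> {}\<close> by (metis LeastI ex_in_conv, metis Least_le)
  have up: "i \<in> ?S" if "a \<le> i" for i
  proof -
    obtain k where "k \<in> ?S" "i \<le> k"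
      using inf unfolding infinite_nat_iff_unbounded_le by blast
    then show ?thesis using nat_intervalD[OF int a(1)] that by blast
  qed
  let ?D = "\<lambda>i. (real i * pmf f i - real i * pmf g i) - real a * (pmf f i - pmf g i)"
  have D: "?D i = (real i - real a) * (pmf f i - pmf g i)" for i by (simp add: algebra_simps)
  have "(\<lambda>i. real i * pmf f i) sums (\<Sum>i. real i * pmf g i)"
    using f mean by (intro pmf_mean_eq_sums) (auto simp: lc_class_def)
  then have sums: "?D sums ((\<Sum>i. real i * pmf g i) - (\<Sum>i. real i * pmf g i) - real a * (1 - 1))"
    using mean by (intro sums_diff sums_mult pmf_sums_one summable_sums)
  have nonneg: "0 \<le> ?D i" for i
  proof (cases "a \<le> i")
    case True
    then show ?thesis using up[OF True] unfolding D by simp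
  next
    case False
    then have "i \<notin> ?S" using a(2) by blast
    then have "pmf f i \<le> pmf g i" by (simp add: not_less)
    then show ?thesis using False unfolding D by (intro mult_nonpos_nonpos) auto
  qed
  have "0 < ?D (Suc a)" using up[of "Suc a"] unfolding D by simp
  then have "0 < suminf ?D"
    by (rule suminf_pos2[OF sums_summable[OF sums] nonneg])
  then show False using sums by (simp add: sums_iff)
qed

text \<open>This is where the two concavity conditions meet: one makes \<open>{i. f i > g i}\<close> an interval, and
  the other separates \<open>ln g\<close> on this interval from \<open>ln g\<close> off it by a line.\<close>

lemma lc_class_affine_comparison:
  assumes g: "log_concave (pmf g)" and f: "f \<in> lc_class g" and "f \<noteq> g"
  shows "\<exists>s t. \<forall>i. 0 < pmf g i \<longrightarrow>
    0 \<le> (pmf f i - pmf g i) * (ln (pmf g i) - (s + t * real i))"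
proof -
  let ?S = "{i. pmf g i < pmf f i}"
  have int: "nat_interval ?S" using f lc_le_greater_interval by (simp add: lc_class_def)
  have fin: "finite ?S"
    using lc_class_greater_bounded[OF f] log_concave_pmf_finite_mean_entropy(1)[OF g] by simp
  have ne: "?S \<noteq> {}" using pmf_neq_imp_greater[OF \<open>f \<noteq> g\<close>] by blast
  define a where "a = Min ?S"
  define b where "b = Max ?S"
  have ab: "a \<in> ?S" "b \<in> ?S" using fin ne Min_in Max_in unfolding a_def b_def by blast+
  have S: "?S = {a..b}"
  proof
    show "?S \<subseteq> {a..b}" using fin unfolding a_def b_def by auto
    show "{a..b} \<subseteq> ?S" using int ab unfolding nat_interval_def by blast
  qed
  have pos: "0 < pmf g i" if "i \<in> ?S" for i
    using that f lc_le_greater_pos(2)[of f g i] by (simp add: lc_class_def)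
  have "a \<le> b" using ab fin unfolding a_def by simp
  then obtain s t where st: "\<And>m. m \<in> {a..b} \<Longrightarrow> s + t * real m \<le> ln (pmf g m)"
      "\<And>m. 0 < pmf g m \<Longrightarrow> m \<notin> {a..b} \<Longrightarrow> ln (pmf g m) \<le> s + t * real m"
    using log_concave_separating_line[OF g pos[OF ab(1)] pos[OF ab(2)]] by blast
  have "0 \<le> (pmf f i - pmf g i) * (ln (pmf g i) - (s + t * real i))" if "0 < pmf g i" for i
  proof (cases "i \<in> ?S")
    case True
    then show ?thesis using st(1)[of i] unfolding S[symmetric] by (intro mult_nonneg_nonneg) auto
  next
    case False
    then show ?thesis
      using st(2)[OF that] unfolding S[symmetric] by (intro mult_nonpos_nonpos) auto
  qed
  then show ?thesis by blast
qed

section \<open>Entropy comparison\<close>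

text \<open>The tangent inequality \<open>ln z \<le> z - 1\<close> at \<open>z = y / x\<close>, multiplied by \<open>x\<close>.\<close>

lemma gibbs_pointwise:
  fixes x y :: real
  assumes "0 \<le> x" "0 < y"
  shows "- (x * ln x) \<le> - (x * ln y) + (y - x)"
    and "x \<noteq> y \<Longrightarrow> - (x * ln x) < - (x * ln y) + (y - x)"
proof -
  have le: "- (x * ln x) \<le> - (x * ln y) + (y - x) \<and>
      (x \<noteq> y \<longrightarrow> - (x * ln x) < - (x * ln y) + (y - x))"
  proof (cases "x = 0")
    case False
    then have x: "0 < x" using assms by simp
    have "ln (y / x) \<le> y / x - 1" using x assms by (intro ln_le_minus_one) simp
    moreover have "ln (y / x) \<noteq> y / x - 1" if "x \<noteq> y"
      using ln_eq_minus_one[of "y / x"] x assms that by auto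
    ultimately have "x * ln (y / x) \<le> x * (y / x - 1) \<and>
        (x \<noteq> y \<longrightarrow> x * ln (y / x) < x * (y / x - 1))"
      using x by (auto simp: less_le)
    moreover have "x * ln (y / x) = x * ln y - x * ln x" "x * (y / x - 1) = y - x"
      using x assms by (simp_all add: ln_div algebra_simps)
    ultimately show ?thesis by auto
  qed (use assms in auto)
  then show "- (x * ln x) \<le> - (x * ln y) + (y - x)"
    and "x \<noteq> y \<Longrightarrow> - (x * ln x) < - (x * ln y) + (y - x)" by auto
qed

lemma shannon_entropy_eq:
  assumes "summable (\<lambda>i. - (pmf f i * ln (pmf f i)))"
  shows "shannon_entropy f = ennreal (\<Sum>i. - (pmf f i * ln (pmf f i)))"
  unfolding shannon_entropy_def
  using assms by (intro suminf_ennreal2 neg_mult_ln_nonneg pmf_nonneg pmf_le_1)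

lemma lc_class_entropy_less:
  assumes g: "log_concave (pmf g)" and f: "f \<in> lc_class g" and "f \<noteq> g"
  shows "shannon_entropy f < shannon_entropy g"
proof -
  let ?Hf = "\<lambda>i. - (pmf f i * ln (pmf f i))"
  let ?Hg = "\<lambda>i. - (pmf g i * ln (pmf g i))"
  obtain s t where st: "\<And>i. 0 < pmf g i \<Longrightarrow>
      0 \<le> (pmf f i - pmf g i) * (ln (pmf g i) - (s + t * real i))"
    using lc_class_affine_comparison[OF g f \<open>f \<noteq> g\<close>] by blast
  note sum_g = log_concave_pmf_finite_mean_entropy[OF g]
  have mean_f: "(\<lambda>i. real i * pmf f i) sums (\<Sum>i. real i * pmf g i)"
    using f sum_g(1) by (intro pmf_mean_eq_sums) (auto simp: lc_class_def)
  \<comment> \<open>\<open>?T\<close> is \<open>- g ln g + (g - f) l + (g - f)\<close> with \<open>l i = s + t * i\<close>, arranged as a combination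
    of the series for mass and mean.\<close>
  let ?T = "\<lambda>i. ?Hg i + ((s + 1) * (pmf g i - pmf f i)
    + t * (real i * pmf g i - real i * pmf f i))"
  have "?T sums (suminf ?Hg + ((s + 1) * (1 - 1)
      + t * ((\<Sum>i. real i * pmf g i) - (\<Sum>i. real i * pmf g i))))"
    by (intro sums_add sums_mult sums_diff pmf_sums_one mean_f summable_sums[OF sum_g(1)]
        summable_sums[OF sum_g(2)])
  then have T: "?T sums suminf ?Hg" by simp
  have T_ge: "- (pmf f i * ln (pmf g i)) + (pmf g i - pmf f i) \<le> ?T i" if "0 < pmf g i" for i
    using st[OF that] by (simp add: algebra_simps)
  have zero: "pmf f i = 0" if "\<not> 0 < pmf g i" for i
  proof -
    have "i \<notin> set_pmf g" using that by (auto dest: pmf_positive)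
    then show ?thesis using f by (auto simp: lc_class_def lc_le_def pmf_eq_0_set_pmf)
  qed
  have le: "?Hf i \<le> ?T i" for i
  proof (cases "0 < pmf g i")
    case True
    then show ?thesis
      using T_ge[of i] gibbs_pointwise(1)[of "pmf f i" "pmf g i"] by simp
  next
    case False
    then have "pmf g i = 0" using pmf_nonneg[of g i] by linarith
    then show ?thesis using zero[OF False] by simp
  qed
  have Hf_nonneg: "0 \<le> ?Hf i" for i
    by (intro neg_mult_ln_nonneg pmf_nonneg pmf_le_1)
  have sum_f: "summable ?Hf"
  proof (rule summable_comparison_test')
    show "summable ?T" using T by (rule sums_summable)
    show "norm (?Hf i) \<le> ?T i" for i
      using le[of i] Hf_nonneg[of i] by (simp only: real_norm_def abs_of_nonneg)
  qed
  obtain i where i: "pmf g i < pmf f i" using pmf_neq_imp_greater[OF \<open>f \<noteq> g\<close>] by blast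
  have gi: "0 < pmf g i"
    using f i lc_le_greater_pos(2)[of f g i] by (simp add: lc_class_def)
  have "?Hf i < ?T i"
    using T_ge[OF gi] gibbs_pointwise(2)[of "pmf f i" "pmf g i"] gi i by simp
  then have "0 < ?T i - ?Hf i" by (simp only: diff_gt_0_iff_gt)
  moreover have "0 \<le> ?T n - ?Hf n" for n using le[of n] by (simp only: diff_ge_0_iff_ge)
  ultimately have "0 < (\<Sum>i. ?T i - ?Hf i)"
    by (intro suminf_pos2[of _ i] summable_diff sum_f sums_summable[OF T])
  also have "\<dots> = suminf ?Hg - suminf ?Hf"
    using sums_diff[OF T summable_sums[OF sum_f]] by (rule sums_unique[symmetric])
  finally have "suminf ?Hf < suminf ?Hg" by simp
  moreover have "0 \<le> suminf ?Hf" by (rule suminf_nonneg[OF sum_f Hf_nonneg])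
  ultimately show ?thesis
    by (simp only: shannon_entropy_eq[OF sum_f] shannon_entropy_eq[OF sum_g(2)] ennreal_less_iff)
qed

lemma lc_le_refl:
  assumes "nat_interval (set_pmf g)"
  shows "g \<le>lc g"
proof -
  have "ln (pmf g i / pmf g i) = 0" for i by (cases "pmf g i = 0") auto
  then show ?thesis using assms by (simp add: lc_le_def concave_nat_on_def)
qed

theorem theorem5:
  fixes g :: "nat pmf"
  assumes "log_concave (pmf g)"
  shows "g \<in> lc_class g \<and>
    (\<forall>f\<in>lc_class g. f \<noteq> g \<longrightarrow> shannon_entropy f < shannon_entropy g)"
proof -
  have "set_pmf g = {i. 0 < pmf g i}"
    by (auto simp: set_pmf_iff less_le)
  then have "nat_interval (set_pmf g)" using assms by (simp add: log_concave_def)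
  then have "g \<in> lc_class g" by (simp add: lc_class_def lc_le_refl)
  then show ?thesis using lc_class_entropy_less[OF assms] by blast
qed

end
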